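(* Let $(X,\|\cdot\|)$ be a real Banach space and let $f:X\to\overline{\mathbb R}$ be lower semicontinuous near $x\in X$ (i.e. on a neighborhood of $x$). Then $$\eth f(x)\subset\partial_C f(x),$$ where $\partial_C f$ denotes the Clarke–Rockafellar subdifferential for extended-real lower semicontinuous functions.
   Context: $\overline{\mathbb R}=[-\infty,+\infty]$, $\langle x,x^*\rangle:=x^*(x)$, and $\overline B(x_0;r)$ is the closed norm ball. Core subdifferential (for the norm metric): for $f:X\to\overline{\mathbb R}$ and $x_0\in X$, $x_0^*\in X^*$ belongs to $\eth f(x_0)$ if $f(x_0)\in\mathbb R$ and there is a family $(\delta_\varepsilon)_{\varepsilon>0}\subset(0,+\infty)$ with $\limsup_{\varepsilon\downarrow0}\delta_\varepsilon/\varepsilon=+\infty$ such that $f(x_0)+\langle x-x_0,x_0^*\rangle\le f(x)+\varepsilon$ for every $\varepsilon>0$ and every $x\in\overline B(x_0;\delta_\varepsilon)$. If $f(x_0)\notin\mathbb R$, then $\eth f(x_0)=\emptyset$. Clarke–Rockafellar subdifferential (standard definition): for $f$ lower semicontinuous near $x$ with $f(x)\in\mathbb R$, set $$f^{\uparrow}(x;v):=\lim_{\eta\downarrow0}\ \limsup_{y\to_f x,\ t\downarrow0}\ \inf_{\|w-v\|\le\eta}\frac{f(y+tw)-f(y)}{t},$$ where $y\to_f x$ means $y\to x$ and $f(y)\to f(x)$; then $\partial_C f(x):=\{x^*\in X^*\mid\langle v,x^*\rangle\le f^{\uparrow}(x;v)\ \forall v\in X\}$, and $\partial_C f(x):=\emptyset$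 if $f(x)\notin\mathbb R$. *)

theory Defs
  imports "HOL-Analysis.Analysis"
begin

definition lsc_at :: "('a::topological_space \<Rightarrow> ereal) \<Rightarrow> 'a \<Rightarrow> bool" where
  "lsc_at f x \<longleftrightarrow> f x \<le> Liminf (nhds x) f"

definition lsc_near :: "('a::topological_space \<Rightarrow> ereal) \<Rightarrow> 'a \<Rightarrow> bool" where
  "lsc_near f x \<longleftrightarrow> (\<exists>U. open U \<and> x \<in> U \<and> (\<forall>u\<in>U. lsc_at f u))"

(* The family is a total function on the reals; only its values at positive arguments
   are constrained. *)
definition core_subdiff ::
  "('a::real_normed_vector \<Rightarrow> ereal) \<Rightarrow> 'a \<Rightarrow> ('a \<Rightarrow>\<^sub>L real) set" where
  "core_subdiff f x0 = {xs. \<bar>f x0\<bar> \<noteq> \<infinity> \<and>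
     (\<exists>\<delta>::real \<Rightarrow> real.
        (\<forall>\<epsilon>>0. \<delta> \<epsilon> > 0) \<and>
        Limsup (at_right 0) (\<lambda>\<epsilon>. ereal (\<delta> \<epsilon> / \<epsilon>)) = \<infinity> \<and>
        (\<forall>\<epsilon>>0. \<forall>x\<in>cball x0 (\<delta> \<epsilon>).
           f x0 + ereal (blinfun_apply xs (x - x0)) \<le> f x + ereal \<epsilon>))}"

(* y tends to x and f y tends to f x; the value y = x is not excluded. *)
definition nhds_attentive ::
  "('a::topological_space \<Rightarrow> ereal) \<Rightarrow> 'a \<Rightarrow> 'a filter" where
  "nhds_attentive f x = inf (nhds x) (filtercomap f (nhds (f x)))"

(* When f x is finite, f y is finite for all y eventually in nhds_attentive f x, so the
   difference below is never of the form infinity minus infinity in the limit. *)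
definition cr_quotient ::
  "('a::real_normed_vector \<Rightarrow> ereal) \<Rightarrow> 'a \<Rightarrow> 'a \<Rightarrow> real \<Rightarrow> ereal" where
  "cr_quotient f x v \<eta> =
     Limsup (nhds_attentive f x \<times>\<^sub>F at_right 0)
       (\<lambda>(y, t). INF w\<in>cball v \<eta>. (f (y + t *\<^sub>R w) - f y) / ereal t)"

definition cr_deriv ::
  "('a::real_normed_vector \<Rightarrow> ereal) \<Rightarrow> 'a \<Rightarrow> 'a \<Rightarrow> ereal" where
  "cr_deriv f x v = Lim (at_right 0) (cr_quotient f x v)"

definition clarke_subdiff ::
  "('a::real_normed_vector \<Rightarrow> ereal) \<Rightarrow> 'a \<Rightarrow> ('a \<Rightarrow>\<^sub>L real) set" where
  "clarke_subdiff f x =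
     {xs. \<bar>f x\<bar> \<noteq> \<infinity> \<and> (\<forall>v. ereal (blinfun_apply xs v) \<le> cr_deriv f x v)}"

lemma cr_quotient_antimono:
  assumes "\<eta> \<le> \<eta>'"
  shows "cr_quotient f x v \<eta>' \<le> cr_quotient f x v \<eta>"
  unfolding cr_quotient_def
proof (rule Limsup_mono, rule always_eventually, clarify)
  fix y and t :: real
  show "(INF w\<in>cball v \<eta>'. (f (y + t *\<^sub>R w) - f y) / ereal t)
      \<le> (INF w\<in>cball v \<eta>. (f (y + t *\<^sub>R w) - f y) / ereal t)"
    using assms by (intro INF_superset_mono) auto
qed

(* The limit defining cr_deriv always exists. *)
lemma cr_quotient_tendsto:
  "(cr_quotient f x v \<longlongrightarrow> (SUP \<eta>\<in>{0<..}. cr_quotient f x v \<eta>)) (at_right 0)"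
proof (rule increasing_tendsto)
  show "\<forall>\<^sub>F \<eta> in at_right 0. cr_quotient f x v \<eta> \<le> (SUP \<eta>\<in>{0<..}. cr_quotient f x v \<eta>)"
    unfolding eventually_at_filter by (auto intro!: always_eventually SUP_upper)
next
  fix l assume "l < (SUP \<eta>\<in>{0<..}. cr_quotient f x v \<eta>)"
  then obtain \<eta>0 where "\<eta>0 > 0" "l < cr_quotient f x v \<eta>0"
    by (auto simp: less_SUP_iff)
  then have "l < cr_quotient f x v \<eta>" if "0 < \<eta>" "\<eta> < \<eta>0" for \<eta>
    using cr_quotient_antimono[of \<eta> \<eta>0 f x v] that by (auto elim: order_less_le_trans)
  then show "\<forall>\<^sub>F \<eta> in at_right 0. l < cr_quotient f x v \<eta>"
    using \<open>\<eta>0 > 0\<close> unfolding eventually_at_right_field by blast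
qed

lemma cr_deriv_eq_SUP: "cr_deriv f x v = (SUP \<eta>\<in>{0<..}. cr_quotient f x v \<eta>)"
  unfolding cr_deriv_def by (intro tendsto_Lim cr_quotient_tendsto) simp

end

theory Submission
  imports Defs
begin

text \<open>
  Subtracting the functional and translating, think of the case where the core subgradient is 0
  and \<open>x = 0\<close>, \<open>f 0 = 0\<close>. The hypothesis then says that for every \<open>M\<close> there are arbitrarily
  small \<open>\<epsilon>\<close> such that \<open>f \<ge> - \<epsilon>\<close> on the ball of radius \<open>M * \<epsilon>\<close>: the origin is an
  \<open>\<epsilon>\<close>-minimizer on a ball whose radius is much larger than \<open>\<epsilon>\<close>. Ekeland's variational principle
  (\<open>ekeland_variational_principle\<close>) with slope \<open>\<sigma> = 2 / M\<close> moves the origin by at most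
  \<open>\<epsilon> / \<sigma>\<close>, half of that radius, to an exact minimizer \<open>y\<close> of \<open>f + \<sigma> * norm (\<cdot> - y)\<close> on the ball.
  So \<open>y\<close> lies in the interior of the ball, \<open>f y\<close> is in \<open>[-\<epsilon>, 0]\<close>, and \<open>f\<close> descends from \<open>y\<close>
  with slope at most \<open>\<sigma>\<close> in every direction; this is \<open>core_subdiff_nearby_support\<close>.

  The upper limit in the Clarke-Rockafellar derivative runs over all base points \<open>y\<close> with \<open>y\<close> and
  \<open>f y\<close> close to \<open>x\<close> and \<open>f x\<close>, hence it sees these points, and the difference quotients there are
  bounded below by \<open>- \<sigma> * norm w\<close>. Since \<open>\<sigma>\<close> is arbitrary, the derivative is nonnegative
  (\<open>cr_quotient_lower_bound\<close>). Completeness of the space and lower semicontinuity enter only through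
  Ekeland's principle.
\<close>

section \<open>Ekeland's variational principle\<close>

text \<open>
  Order \<open>S\<close> by \<open>w \<preceq> u\<close> iff \<open>h w + \<sigma> * dist u w \<le> h u\<close>; the conclusion asks for a minimal element
  below \<open>x\<close>. A descending sequence that is greedy, each step coming within \<open>1 / (n + 1)\<close> of the
  infimum of \<open>h\<close> over the points still below, has lower sections whose diameters shrink to 0. They
  are closed because the sublevel sets of \<open>h\<close> are, so they meet in exactly one point, which is
  minimal.
\<close>

theorem ekeland_variational_principle:
  fixes h :: "'a::complete_space \<Rightarrow> real"
  assumes lsc: "\<And>c. closed {u\<in>S. h u \<le> c}"
    and below: "\<And>u. u \<in> S \<Longrightarrow> b \<le> h u"
    and "x \<in> S" and "\<sigma> > 0"
  obtains y where "y \<in> S" "h y + \<sigma> * dist x y \<le> h x"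
    "\<And>w. \<lbrakk>w \<in> S; w \<noteq> y\<rbrakk> \<Longrightarrow> h y < h w + \<sigma> * dist y w"
proof -
  define F where "F u = {w\<in>S. h w + \<sigma> * dist u w \<le> h u}" for u
  have F_refl: "u \<in> F u" if "u \<in> S" for u
    using that by (simp add: F_def)
  have F_trans: "w' \<in> F u" if "w' \<in> F w" "w \<in> F u" for u w w'
  proof -
    have "\<sigma> * dist u w' \<le> \<sigma> * (dist u w + dist w w')"
      using \<open>\<sigma> > 0\<close> by (intro mult_left_mono dist_triangle) auto
    then show ?thesis
      using that by (simp add: F_def distrib_left)
  qed
  \<comment> \<open>The set \<open>F u\<close> is not itself a sublevel set of \<open>h\<close>, but along a convergent sequence in \<open>F u\<close> the
    distance term is eventually within \<open>e\<close> of its limit, which puts the tail into a sublevel set.\<close>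
  have closed_F: "l \<in> F u"
    if lim: "X \<longlonglongrightarrow> l" and X: "\<forall>\<^sub>F n in sequentially. X n \<in> F u" for X l u
  proof -
    have bound: "l \<in> S \<and> h l \<le> h u - \<sigma> * dist u l + e" if "e > 0" for e
    proof -
      have "(\<lambda>n. h u - \<sigma> * dist u (X n)) \<longlonglongrightarrow> h u - \<sigma> * dist u l"
        by (intro tendsto_intros lim)
      then have "\<forall>\<^sub>F n in sequentially. h u - \<sigma> * dist u (X n) < h u - \<sigma> * dist u l + e"
        using \<open>e > 0\<close> by (intro order_tendstoD) auto
      then have "\<forall>\<^sub>F n in sequentially. X n \<in> {w\<in>S. h w \<le> h u - \<sigma> * dist u l + e}"
        using X by eventually_elim (auto simp: F_def)
      then show ?thesis
        using Lim_in_closed_set[OF lsc _ _ lim] by force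
    qed
    then have "h l \<le> h u - \<sigma> * dist u l"
      using bound by (intro field_le_epsilon[where y = "h u - \<sigma> * dist u l"]) auto
    moreover have "l \<in> S"
      using bound[of 1] by simp
    ultimately show ?thesis
      by (simp add: F_def)
  qed
  have near_best: "\<exists>w\<in>F u. \<forall>w'\<in>F u. h w \<le> h w' + e" if "u \<in> S" "e > 0" for u e
  proof -
    have ne: "h ` F u \<noteq> {}" and bdd: "bdd_below (h ` F u)"
      using F_refl[OF \<open>u \<in> S\<close>] below by (auto simp: F_def intro!: bdd_belowI[of _ b])
    obtain w where "w \<in> F u" "h w < Inf (h ` F u) + e"
      using cInf_lessD[OF ne, of "Inf (h ` F u) + e"] \<open>e > 0\<close> by auto
    moreover have "h w \<le> h w' + e" if "w' \<in> F u" for w'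
      using cINF_lower[OF bdd that] \<open>h w < Inf (h ` F u) + e\<close> by linarith
    ultimately show ?thesis
      by blast
  qed
  have "\<exists>u. \<forall>n. u n \<in> F x \<and> (u (Suc n) \<in> F (u n) \<and>
    (\<forall>w\<in>F (u n). h (u (Suc n)) \<le> h w + inverse (real (Suc n))))"
  proof (rule dependent_nat_choice)
    show "\<exists>u. u \<in> F x"
      using F_refl \<open>x \<in> S\<close> by blast
    fix u n assume "u \<in> F x"
    then obtain w where "w \<in> F u" "\<forall>w'\<in>F u. h w \<le> h w' + inverse (real (Suc n))"
      using near_best[of u "inverse (real (Suc n))"] by (auto simp: F_def)
    then show "\<exists>w. w \<in> F x \<and> (w \<in> F u \<and> (\<forall>w'\<in>F u. h w \<le> h w' + inverse (real (Suc n))))"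
      using F_trans \<open>u \<in> F x\<close> by blast
  qed
  then obtain u where u0: "\<And>n. u n \<in> F x" and uSuc: "\<And>n. u (Suc n) \<in> F (u n)"
    and best: "\<And>n w. w \<in> F (u n) \<Longrightarrow> h (u (Suc n)) \<le> h w + inverse (real (Suc n))"
    by blast
  have chain: "u m \<in> F (u n)" if "n \<le> m" for m n
    using that
  proof (induction rule: dec_induct)
    case base
    show ?case using u0[of n] by (intro F_refl) (simp add: F_def)
  next
    case (step k)
    then show ?case using uSuc F_trans by blast
  qed
  have small: "dist (u (Suc n)) w \<le> inverse (real (Suc n)) / \<sigma>" if "w \<in> F (u (Suc n))" for n w
  proof -
    have "h (u (Suc n)) \<le> h w + inverse (real (Suc n))"
      using best F_trans[OF that uSuc] by blast
    then have "\<sigma> * dist (u (Suc n)) w \<le> inverse (real (Suc n))"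
      using that by (simp add: F_def)
    then show ?thesis
      using \<open>\<sigma> > 0\<close> by (simp add: pos_le_divide_eq mult.commute)
  qed
  have radius: "(\<lambda>n. inverse (real (Suc n)) / \<sigma>) \<longlonglongrightarrow> 0"
    using tendsto_divide[OF LIMSEQ_inverse_real_of_nat tendsto_const, of \<sigma>] \<open>\<sigma> > 0\<close> by simp
  have "Cauchy u"
    unfolding Cauchy_altdef2
  proof (intro allI impI)
    fix e :: real assume "e > 0"
    then obtain n where "inverse (real (Suc n)) / \<sigma> < e"
      using eventually_happens'[OF _ order_tendstoD(2)[OF radius \<open>e > 0\<close>]] by auto
    then have "dist (u m) (u (Suc n)) < e" if "m \<ge> Suc n" for m
      using small[OF chain[OF that]] by (simp add: dist_commute)
    then show "\<exists>N. \<forall>n\<ge>N. dist (u n) (u N) < e"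
      by blast
  qed
  then obtain y where lim: "u \<longlonglongrightarrow> y"
    by (auto simp: Cauchy_convergent_iff convergent_def)
  have yF: "y \<in> F (u n)" for n
    using lim by (rule closed_F) (auto simp: eventually_sequentially intro: chain)
  have yx: "y \<in> F x"
    using F_trans yF u0 by blast
  have unique: "w = y" if "w \<in> F y" for w
  proof -
    have "(\<lambda>n. dist (u (Suc n)) w) \<longlonglongrightarrow> 0"
      by (rule tendsto_sandwich[OF _ _ tendsto_const radius])
        (intro always_eventually allI small F_trans[OF that yF] zero_le_dist)+
    then have "(\<lambda>n. u (Suc n)) \<longlonglongrightarrow> w"
      by (rule iffD2[OF tendsto_dist_iff])
    then show ?thesis
      using LIMSEQ_Suc[OF lim] LIMSEQ_unique by blast
  qed
  show thesis
  proof (rule that)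
    show "y \<in> S" "h y + \<sigma> * dist x y \<le> h x"
      using yx by (auto simp: F_def)
    show "h y < h w + \<sigma> * dist y w" if "w \<in> S" "w \<noteq> y" for w
      using that unique[of w] by (force simp: F_def)
  qed
qed

section \<open>Core subgradients support the function at nearby points\<close>

text \<open>
  Lower semicontinuity of an extended-valued function minus an affine one, stated without a
  difference of extended reals. In this form it supplies the closed sublevel sets that Ekeland's
  principle needs.
\<close>

lemma closed_affine_sublevel:
  fixes f :: "'a::real_normed_vector \<Rightarrow> ereal" and xs :: "'a \<Rightarrow>\<^sub>L real"
  assumes "closed C" and lsc: "\<And>u. u \<in> C \<Longrightarrow> lsc_at f u"
  shows "closed {u\<in>C. f u \<le> ereal (c + xs (u - x))}"
  unfolding closed_sequential_limits
proof (intro allI impI, elim conjE)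
  fix X l
  assume X: "\<forall>n. X n \<in> {u\<in>C. f u \<le> ereal (c + xs (u - x))}" and lim: "X \<longlonglongrightarrow> l"
  have "l \<in> C"
    using X lim \<open>closed C\<close> by (auto simp: closed_sequential_limits)
  have "f l \<le> ereal (c + xs (l - x))"
  proof (rule ccontr)
    assume "\<not> f l \<le> ereal (c + xs (l - x))"
    then obtain z where z: "ereal (c + xs (l - x)) < z" "z < f l"
      using dense not_le by metis
    have "z < Liminf (nhds l) f"
      using z(2) lsc[OF \<open>l \<in> C\<close>] by (auto simp: lsc_at_def)
    then have "\<forall>\<^sub>F n in sequentially. z < f (X n)"
      using lim by (intro eventually_compose_filterlim[OF less_LiminfD])
    moreover have "(\<lambda>n. ereal (c + xs (X n - x))) \<longlonglongrightarrow> ereal (c + xs (l - x))"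
      by (intro tendsto_intros lim)
    then have "\<forall>\<^sub>F n in sequentially. ereal (c + xs (X n - x)) < z"
      using z(1) by (rule order_tendstoD)
    ultimately have "\<forall>\<^sub>F n in sequentially. False"
    proof eventually_elim
      case (elim n)
      have "f (X n) \<le> ereal (c + xs (X n - x))"
        using X by blast
      then show False
        using elim by order
    qed
    then show False
      by simp
  qed
  then show "l \<in> {u\<in>C. f u \<le> ereal (c + xs (u - x))}"
    using \<open>l \<in> C\<close> by simp
qed

text \<open>
  An infinite upper limit of \<open>\<delta> \<epsilon> / \<epsilon>\<close> means that the ratio exceeds \<open>M\<close> for arbitrarily small \<open>\<epsilon>\<close>;
  for those the radius \<open>\<delta> \<epsilon>\<close> may be replaced by the smaller \<open>M * \<epsilon>\<close>. The radius is then small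
  together with \<open>\<epsilon>\<close>, even if \<open>\<delta>\<close> does not tend to 0.
\<close>

lemma core_subdiff_scales:
  fixes f :: "'a::real_normed_vector \<Rightarrow> ereal"
  assumes "xs \<in> core_subdiff f x" and "M > 0" and "\<tau> > 0"
  obtains \<epsilon> where "0 < \<epsilon>" "\<epsilon> < \<tau>"
    "\<And>u. u \<in> cball x (M * \<epsilon>) \<Longrightarrow> f x + ereal (xs (u - x)) \<le> f u + ereal \<epsilon>"
proof -
  obtain \<delta> :: "real \<Rightarrow> real"
    where Limsup: "Limsup (at_right 0) (\<lambda>\<epsilon>. ereal (\<delta> \<epsilon> / \<epsilon>)) = \<infinity>"
      and \<delta>: "\<And>\<epsilon> u. \<lbrakk>\<epsilon> > 0; u \<in> cball x (\<delta> \<epsilon>)\<rbrakk> \<Longrightarrow> f x + ereal (xs (u - x)) \<le> f u + ereal \<epsilon>"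
    using assms(1) unfolding core_subdiff_def by blast
  have "\<exists>\<^sub>F \<epsilon> in at_right 0. \<delta> \<epsilon> / \<epsilon> > M"
  proof (rule ccontr)
    assume "\<not> ?thesis"
    then have "Limsup (at_right 0) (\<lambda>\<epsilon>. ereal (\<delta> \<epsilon> / \<epsilon>)) \<le> ereal M"
      by (intro Limsup_bounded) (simp add: not_frequently not_less)
    then show False
      using Limsup by simp
  qed
  moreover have "\<forall>\<^sub>F \<epsilon>::real in at_right 0. 0 < \<epsilon> \<and> \<epsilon> < \<tau>"
    using \<open>\<tau> > 0\<close> by (auto simp: eventually_at_right_field)
  ultimately have "\<exists>\<^sub>F \<epsilon> in at_right 0. \<delta> \<epsilon> / \<epsilon> > M \<and> 0 < \<epsilon> \<and> \<epsilon> < \<tau>"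
    by (rule frequently_eventually_frequently)
  then obtain \<epsilon> where \<epsilon>: "\<delta> \<epsilon> / \<epsilon> > M" "0 < \<epsilon>" "\<epsilon> < \<tau>"
    by (blast dest: frequently_ex)
  then have "M * \<epsilon> \<le> \<delta> \<epsilon>"
    by (simp add: pos_less_divide_eq)
  then show thesis
    using that[OF \<epsilon>(2,3)] \<delta>[OF \<epsilon>(2)] by auto
qed

text \<open>
  Although \<open>x\<close> is only an approximate minimizer of \<open>f - xs\<close> at each scale, Ekeland's principle gives
  points, arbitrarily close to \<open>x\<close> in position and in value, where \<open>f - xs\<close> has a genuine local
  minimum up to a cone of arbitrarily small slope. The principle is applied to \<open>f - xs\<close> on the part of
  the ball where it does not exceed its value at \<open>x\<close>: there it is real-valued, and the points left
  out have larger values, so that they cannot violate the minimality.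
\<close>

lemma core_subdiff_nearby_support:
  fixes f :: "'a::banach \<Rightarrow> ereal"
  assumes core: "xs \<in> core_subdiff f x" and "lsc_near f x"
    and "\<sigma> > 0" and "\<rho> > 0" and fx: "f x = ereal a"
  obtains y b s where "dist y x < \<rho>" "f y = ereal b" "dist b a < \<rho>" "s > 0"
    "\<And>z. dist z y < s \<Longrightarrow> ereal (b + xs (z - y) - \<sigma> * norm (z - y)) \<le> f z"
proof -
  obtain r where "r > 0" and lsc: "\<And>u. u \<in> cball x r \<Longrightarrow> lsc_at f u"
    using assms(2) open_contains_cball unfolding lsc_near_def by (metis subsetD)
  \<comment> \<open>\<open>M\<close> makes the Ekeland displacement \<open>\<epsilon> / \<sigma>\<close> half the radius \<open>M * \<epsilon>\<close>. The bound
    \<open>K * \<epsilon> < min r \<rho>\<close> keeps the ball in the region of lower semicontinuity and controls the change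
    of \<open>f\<close>, at most \<open>norm xs * (M * \<epsilon>) + \<epsilon>\<close>.\<close>
  define M where "M = 2 / \<sigma>"
  define K where "K = (norm xs + 1) * M + 1"
  have "M > 0" and "K \<ge> 1"
    using \<open>\<sigma> > 0\<close> by (auto simp: M_def K_def)
  obtain \<epsilon> where "\<epsilon> > 0" and \<epsilon>: "\<epsilon> < min r \<rho> / K"
    and approx: "\<And>u. u \<in> cball x (M * \<epsilon>) \<Longrightarrow> f x + ereal (xs (u - x)) \<le> f u + ereal \<epsilon>"
    using core_subdiff_scales[OF core \<open>M > 0\<close>, of "min r \<rho> / K"] \<open>r > 0\<close> \<open>\<rho> > 0\<close> \<open>K \<ge> 1\<close>
    by (metis divide_pos_pos less_le_trans min_less_iff_conj zero_less_one)
  have "\<epsilon> * K < min r \<rho>"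
    using \<epsilon> \<open>K \<ge> 1\<close> by (simp add: pos_less_divide_eq)
  then have "norm xs * (M * \<epsilon>) + M * \<epsilon> + \<epsilon> < min r \<rho>"
    by (simp add: K_def algebra_simps)
  moreover have "0 \<le> norm xs * (M * \<epsilon>)" "0 < M * \<epsilon>"
    using \<open>M > 0\<close> \<open>\<epsilon> > 0\<close> by auto
  ultimately have "M * \<epsilon> < r" "M * \<epsilon> < \<rho>" and value_bound: "norm xs * (M * \<epsilon>) + \<epsilon> < \<rho>"
    using \<open>\<epsilon> > 0\<close> unfolding min_less_iff_conj by linarith+
  define S where "S = {u\<in>cball x (M * \<epsilon>). f u \<le> ereal (a + xs (u - x))}"
  define h where "h u = real_of_ereal (f u) - xs (u - x)" for u
  have S_finite: "f u = ereal (h u + xs (u - x))" and S_bounds: "a - \<epsilon> \<le> h u" "h u \<le> a"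
    if "u \<in> S" for u
  proof -
    have "f u \<le> ereal (a + xs (u - x))" "ereal a + ereal (xs (u - x)) \<le> f u + ereal \<epsilon>"
      using that approx[of u] fx by (auto simp: S_def)
    then show "f u = ereal (h u + xs (u - x))" "a - \<epsilon> \<le> h u" "h u \<le> a"
      by (cases "f u"; simp add: h_def)+
  qed
  have closed: "closed {u\<in>S. h u \<le> c}" for c
  proof -
    have "{u\<in>S. h u \<le> c} = {u\<in>cball x (M * \<epsilon>). f u \<le> ereal (min a c + xs (u - x))}" (is "?L = ?R")
    proof (intro equalityI subsetI)
      fix u assume "u \<in> ?L"
      then show "u \<in> ?R"
        using S_finite[of u] S_bounds[of u] by (auto simp: S_def)
    next
      fix u assume u: "u \<in> ?R"
      have "ereal (min a c + xs (u - x)) \<le> ereal (a + xs (u - x))"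
        by simp
      then have "u \<in> S"
        using u unfolding S_def by (blast intro: order_trans)
      then show "u \<in> ?L"
        using u S_finite[of u] by simp
    qed
    then show ?thesis
      using \<open>M * \<epsilon> < r\<close> by (simp only:) (intro closed_affine_sublevel lsc, auto)
  qed
  have "x \<in> S" and "h x = a"
    using \<open>M > 0\<close> \<open>\<epsilon> > 0\<close> fx by (auto simp: S_def h_def blinfun.bilinear_simps)
  obtain y where y: "y \<in> S" "h y + \<sigma> * dist x y \<le> h x"
    and min: "\<And>w. \<lbrakk>w \<in> S; w \<noteq> y\<rbrakk> \<Longrightarrow> h y < h w + \<sigma> * dist y w"
    using ekeland_variational_principle[OF closed S_bounds(1) \<open>x \<in> S\<close> \<open>\<sigma> > 0\<close>] by blast
  have "\<sigma> * dist x y \<le> \<epsilon>"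
    using y S_bounds(1)[of y] \<open>h x = a\<close> by simp
  then have "dist x y \<le> \<epsilon> / \<sigma>"
    using \<open>\<sigma> > 0\<close> by (simp add: pos_le_divide_eq mult.commute)
  also have "\<epsilon> / \<sigma> < M * \<epsilon>"
    using \<open>\<sigma> > 0\<close> \<open>\<epsilon> > 0\<close> by (simp add: M_def field_simps)
  finally have interior: "dist x y < M * \<epsilon>" .
  show thesis
  proof (rule that)
    show "dist y x < \<rho>"
      using interior \<open>M * \<epsilon> < \<rho>\<close> by (simp add: dist_commute)
    show "f y = ereal (h y + xs (y - x))"
      using S_finite y(1) .
    have "\<bar>xs (y - x)\<bar> \<le> norm xs * norm (y - x)"
      using norm_blinfun[of xs "y - x"] by simp
    also have "\<dots> \<le> norm xs * (M * \<epsilon>)"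
      using interior by (intro mult_left_mono) (auto simp: dist_norm norm_minus_commute)
    finally show "dist (h y + xs (y - x)) a < \<rho>"
      using S_bounds[OF y(1)] value_bound by (simp add: dist_real_def)
    show "M * \<epsilon> - dist x y > 0"
      using interior by simp
    fix z assume "dist z y < M * \<epsilon> - dist x y"
    then have "z \<in> cball x (M * \<epsilon>)"
      using dist_triangle[of x z y] by (simp add: dist_commute)
    have split: "xs (z - x) = xs (z - y) + xs (y - x)"
      by (simp add: blinfun.bilinear_simps)
    show "ereal (h y + xs (y - x) + xs (z - y) - \<sigma> * norm (z - y)) \<le> f z"
    proof (cases "z \<in> S")
      case True
      have "h y \<le> h z + \<sigma> * norm (z - y)"
        using min[OF True] by (cases "z = y") (auto simp: dist_norm norm_minus_commute)
      then show ?thesis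
        using S_finite[OF True] split by simp
    next
      case False
      have "ereal (h y + xs (y - x) + xs (z - y) - \<sigma> * norm (z - y)) \<le> ereal (a + xs (z - x))"
        unfolding ereal_less_eq
        using S_bounds(2)[OF y(1)] mult_nonneg_nonneg[OF less_imp_le[OF \<open>\<sigma> > 0\<close>] norm_ge_zero[of "z - y"]]
        split by linarith
      also have "\<dots> \<le> f z"
        using False \<open>z \<in> cball x (M * \<epsilon>)\<close> by (simp add: S_def)
      finally show ?thesis .
    qed
  qed
qed

section \<open>The Clarke-Rockafellar derivative\<close>

lemma eventually_nhds_attentiveD:
  fixes f :: "'a::metric_space \<Rightarrow> ereal"
  assumes "eventually P (nhds_attentive f x)" and fx: "f x = ereal a"
  obtains \<rho> where "\<rho> > 0" "\<And>y b. \<lbrakk>dist y x < \<rho>; f y = ereal b; dist b a < \<rho>\<rbrakk> \<Longrightarrow> P y"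
proof -
  obtain Q R where Q: "eventually Q (nhds x)"
    and "eventually R (filtercomap f (nhds (f x)))" and QR: "\<And>y. \<lbrakk>Q y; R y\<rbrakk> \<Longrightarrow> P y"
    using assms(1) unfolding nhds_attentive_def eventually_inf by blast
  then obtain T where "eventually T (nhds (f x))" and T: "\<And>y. T (f y) \<Longrightarrow> R y"
    unfolding eventually_filtercomap by blast
  have "eventually (\<lambda>b. T (ereal b)) (nhds a)"
    using \<open>eventually T (nhds (f x))\<close> unfolding fx nhds_ereal eventually_filtermap .
  then obtain d2 where "d2 > 0" "\<And>b. dist b a < d2 \<Longrightarrow> T (ereal b)"
    unfolding eventually_nhds_metric by blast
  moreover obtain d1 where "d1 > 0" "\<And>y. dist y x < d1 \<Longrightarrow> Q y"
    using Q unfolding eventually_nhds_metric by blast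
  ultimately show thesis
    by (intro that[of "min d1 d2"]) (auto intro!: QR T)
qed

text \<open>
  If the upper limit were smaller, the difference quotients would be smaller for all \<open>y\<close> near \<open>x\<close> in
  position and value and all small \<open>t > 0\<close>, in particular at a point \<open>y\<close> where the graph of \<open>f\<close> is
  supported from below by \<open>xs\<close> minus a cone of slope \<open>\<sigma>\<close>. The terms \<open>norm xs * \<eta>\<close> and \<open>\<sigma> * (norm v + \<eta>)\<close> are
  the losses from replacing \<open>v\<close> by a direction \<open>w\<close> within \<open>\<eta>\<close> of it and from the cone.
\<close>

lemma cr_quotient_lower_bound:
  fixes f :: "'a::banach \<Rightarrow> ereal"
  assumes core: "xs \<in> core_subdiff f x" and lsc: "lsc_near f x"
    and "\<eta> > 0" and "\<sigma> > 0"
  shows "ereal (xs v - norm xs * \<eta> - \<sigma> * (norm v + \<eta>)) \<le> cr_quotient f x v \<eta>"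
    (is "ereal ?c \<le> _")
proof (rule ccontr)
  obtain a where fx: "f x = ereal a"
    using core by (cases "f x") (auto simp: core_subdiff_def)
  assume "\<not> ereal ?c \<le> cr_quotient f x v \<eta>"
  then have "\<forall>\<^sub>F (y, t) in nhds_attentive f x \<times>\<^sub>F at_right 0.
      (INF w\<in>cball v \<eta>. (f (y + t *\<^sub>R w) - f y) / ereal t) < ereal ?c"
    unfolding cr_quotient_def not_le by (auto dest: Limsup_lessD simp: case_prod_unfold)
  then obtain P Q where P: "eventually P (nhds_attentive f x)" and Q: "eventually Q (at_right (0::real))"
    and PQ: "\<And>y t. \<lbrakk>P y; Q t\<rbrakk> \<Longrightarrow> (INF w\<in>cball v \<eta>. (f (y + t *\<^sub>R w) - f y) / ereal t) < ereal ?c"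
    unfolding eventually_prod_filter by auto
  obtain \<rho> where "\<rho> > 0"
    and \<rho>: "\<And>y b. \<lbrakk>dist y x < \<rho>; f y = ereal b; dist b a < \<rho>\<rbrakk> \<Longrightarrow> P y"
    using eventually_nhds_attentiveD[OF P fx] by blast
  obtain y b s where "P y" and fy: "f y = ereal b" and "s > 0"
    and supp: "\<And>z. dist z y < s \<Longrightarrow> ereal (b + xs (z - y) - \<sigma> * norm (z - y)) \<le> f z"
    using core_subdiff_nearby_support[OF core lsc \<open>\<sigma> > 0\<close> \<open>\<rho> > 0\<close> fx] \<rho> by metis
  obtain \<tau> where "\<tau> > 0" and \<tau>: "\<And>t. \<lbrakk>0 < t; t < \<tau>\<rbrakk> \<Longrightarrow> Q t"
    using Q by (auto simp: eventually_at_right_field)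
  have "norm v + \<eta> > 0"
    using \<open>\<eta> > 0\<close> by (simp add: add_nonneg_pos)
  then have "min \<tau> (s / (norm v + \<eta>)) > 0"
    using \<open>\<tau> > 0\<close> \<open>s > 0\<close> by simp
  then obtain t where "0 < t" "t < \<tau>" "t < s / (norm v + \<eta>)"
    using dense by (metis min_less_iff_conj)
  then have "t * (norm v + \<eta>) < s"
    using \<open>norm v + \<eta> > 0\<close> by (simp add: pos_less_divide_eq)
  have "ereal ?c \<le> (INF w\<in>cball v \<eta>. (f (y + t *\<^sub>R w) - f y) / ereal t)"
  proof (rule INF_greatest)
    fix w assume w: "w \<in> cball v \<eta>"
    then have norm_w: "norm w \<le> norm v + \<eta>"
      using norm_triangle_ineq[of v "w - v"] by (simp add: dist_norm norm_minus_commute)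
    have "dist (y + t *\<^sub>R w) y = t * norm w"
      using \<open>0 < t\<close> by (simp add: dist_norm)
    also have "\<dots> < s"
      using mult_left_mono[OF norm_w less_imp_le[OF \<open>0 < t\<close>]] \<open>t * (norm v + \<eta>) < s\<close>
      by (rule order_le_less_trans)
    finally have bound: "ereal (b + t * (xs w - \<sigma> * norm w)) \<le> f (y + t *\<^sub>R w)"
      using supp[of "y + t *\<^sub>R w"] \<open>0 < t\<close> by (simp add: blinfun.bilinear_simps algebra_simps)
    have "\<bar>xs (w - v)\<bar> \<le> norm xs * norm (w - v)"
      using norm_blinfun[of xs "w - v"] by simp
    also have "\<dots> \<le> norm xs * \<eta>"
      using w by (intro mult_left_mono) (auto simp: dist_norm norm_minus_commute)
    finally have "xs v - norm xs * \<eta> \<le> xs w"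
      by (simp add: blinfun.bilinear_simps)
    moreover have "\<sigma> * norm w \<le> \<sigma> * (norm v + \<eta>)"
      using norm_w \<open>\<sigma> > 0\<close> by (intro mult_left_mono) auto
    ultimately have "ereal ?c \<le> ereal (xs w - \<sigma> * norm w)"
      by simp
    also have "\<dots> \<le> (f (y + t *\<^sub>R w) - f y) / ereal t"
      using bound \<open>0 < t\<close> fy
      by (cases "f (y + t *\<^sub>R w)") (auto simp: pos_le_divide_eq mult.commute)
    finally show "ereal ?c \<le> (f (y + t *\<^sub>R w) - f y) / ereal t" .
  qed
  moreover have "Q t"
    using \<tau> \<open>0 < t\<close> \<open>t < \<tau>\<close> .
  ultimately show False
    using PQ[OF \<open>P y\<close>] by (meson leD)
qed

theorem theorem20:
  fixes f :: "'a::banach \<Rightarrow> ereal" and x :: 'a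
  assumes "lsc_near f x"
  shows "core_subdiff f x \<subseteq> clarke_subdiff f x"
proof
  fix xs assume core: "xs \<in> core_subdiff f x"
  have "ereal (xs v) \<le> cr_deriv f x v" for v
  proof (rule ereal_le_epsilon2)
    fix e :: real assume "e > 0"
    \<comment> \<open>Each of the two losses in the lower bound is at most \<open>e / 2\<close>.\<close>
    define \<eta> where "\<eta> = e / (2 * (norm xs + 1))"
    define \<sigma> where "\<sigma> = e / (2 * (norm v + \<eta>))"
    have "\<eta> > 0"
      using \<open>e > 0\<close> by (simp add: \<eta>_def add_nonneg_pos)
    then have "norm v + \<eta> > 0"
      by (simp add: add_nonneg_pos)
    then have "\<sigma> > 0" and "\<sigma> * (norm v + \<eta>) = e / 2"
      using \<open>e > 0\<close> by (auto simp: \<sigma>_def simp del: distrib_left_numeral)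
    moreover have "norm xs * \<eta> \<le> (norm xs + 1) * \<eta>"
      using \<open>\<eta> > 0\<close> by simp
    moreover have "(norm xs + 1) * \<eta> = e / 2"
      using norm_ge_zero[of xs] by (simp add: \<eta>_def add_nonneg_eq_0_iff del: distrib_left_numeral)
    ultimately have "ereal (xs v) \<le> ereal (xs v - norm xs * \<eta> - \<sigma> * (norm v + \<eta>)) + ereal e"
      by simp
    also have "\<dots> \<le> cr_quotient f x v \<eta> + ereal e"
      by (intro add_right_mono cr_quotient_lower_bound core assms \<open>\<eta> > 0\<close> \<open>\<sigma> > 0\<close>)
    also have "\<dots> \<le> cr_deriv f x v + ereal e"
      unfolding cr_deriv_eq_SUP using \<open>\<eta> > 0\<close> by (intro add_right_mono SUP_upper) simp
    finally show "ereal (xs v) \<le> cr_deriv f x v + ereal e" .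
  qed
  then show "xs \<in> clarke_subdiff f x"
    using core by (simp add: clarke_subdiff_def core_subdiff_def)
qed

end
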